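(* Let $\delta_1=\mathrm{span}\{\frac{i}{\sqrt2}\sigma_1,\frac{i}{\sqrt2}\sigma_2\}\subset\mathfrak{su}(2)$ and let $\widetilde{V}:\mathbb{R}\to\delta_1$ be a null sub-Riemannian Lie quadratic, i.e. a smooth function satisfying $$\dddot{\widetilde{V}}=\big[[\dot{\widetilde{V}},\widetilde{V}],\widetilde{V}\big]$$ (the case $\widetilde{\mathcal{C}}=0$ of the equation $\dddot{\widetilde{V}}=[[\dot{\widetilde{V}},\widetilde{V}],\widetilde{V}]+[\widetilde{\mathcal{C}},\widetilde{V}]$). Suppose $\widetilde{V}(t)\neq0$ for all $t$ and $c_1=\langle\ddot{\widetilde{V}},\widetilde{V}\rangle-\frac12\langle\dot{\widetilde{V}},\dot{\widetilde{V}}\rangle>0$. Put $q(t)=\|\widetilde{V}(t)\|$, $\mathcal{V}=\widetilde{V}+\frac{1}{2\|\widetilde{V}\|^2}\ddot{\widetilde{V}}$, $\alpha_\pm(\widetilde{V})=\lim_{t\to\pm\infty}\widetilde{V}(t)/\|\widetilde{V}(t)\|$, and let $c_2\geq 0$ be the constant value of $\langle\ddot{\widetilde{V}},\ddot{\widetilde{V}}\rangle+\langle[\dot{\widetilde{V}},\widetilde{V}],[\dot{\widetilde{V}},\widetilde{V}]\rangle$. Then, for all $t\in\mathbb{R}$, $$\left\|\frac{\mathcal{V}(t)}{q(t)}-\alpha_{\pm}(\widetilde{V})\right\|\le\frac{\sqrt{c_2}}{2\,q(t)^3}.$$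
   Context: $\sigma_1,\sigma_2,\sigma_3$ are the Pauli matrices. In the general equation $\widetilde{\mathcal{C}}=C\frac{i}{\sqrt2}\sigma_3$ with $C\in\mathbb{R}$ constant. The inner product on $\mathfrak{su}(2)$ is the bi-invariant one $\langle X,Y\rangle=-\mathrm{tr}(XY)$, for which $\frac{i}{\sqrt2}\sigma_1,\frac{i}{\sqrt2}\sigma_2,\frac{i}{\sqrt2}\sigma_3$ are orthonormal, and $\|X\|=\langle X,X\rangle^{1/2}$. The quantities called $c_1$ and $c_2$ are constant in $t$, and the limits $\alpha_\pm(\widetilde{V})$ exist under the stated assumptions.
   Formalization: The bound is not claimed for both signs at every t (false unless the two limits coincide, since q tends to infinity at both ends): it holds with α₊ for t ≥ t₀ and with α₋ for t ≤ t₀, where t₀ is a point at which q is minimal. *)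

theory Defs
  imports "HOL-Analysis.Analysis"
begin

type_synonym cmat2 = "complex^2^2"

definition pauli1 :: cmat2 where
  "pauli1 = vector [vector [0, 1], vector [1, 0]]"

definition pauli2 :: cmat2 where
  "pauli2 = vector [vector [0, - \<i>], vector [\<i>, 0]]"

definition i_over_sqrt2_times :: "cmat2 \<Rightarrow> cmat2" where
  "i_over_sqrt2_times A = (\<chi> j k. \<i> / of_real (sqrt 2) * A $ j $ k)"

definition su2 :: "cmat2 set" where
  "su2 = {X. (\<forall>j k. cnj (X $ k $ j) = - X $ j $ k) \<and> trace X = 0}"

text \<open>The span over the reals.\<close>

definition delta1 :: "cmat2 set" where
  "delta1 = span {i_over_sqrt2_times pauli1, i_over_sqrt2_times pauli2}"

definition bracket :: "cmat2 \<Rightarrow> cmat2 \<Rightarrow> cmat2" where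
  "bracket X Y = X ** Y - Y ** X"

text \<open>On \<open>su2\<close> the trace of a product is real, so \<open>Re\<close> only adjusts the type
  (see \<open>su2_inner_eq_trace\<close>). The resulting norm agrees there with the library norm
  (see \<open>su2_norm_eq_norm\<close>), so limits in the library topology are limits in \<open>su2\<close>.\<close>

definition su2_inner :: "cmat2 \<Rightarrow> cmat2 \<Rightarrow> real" where
  "su2_inner X Y = - Re (trace (X ** Y))"

definition su2_norm :: "cmat2 \<Rightarrow> real" where
  "su2_norm X = sqrt (su2_inner X X)"

lemma su2_entries:
  assumes "X \<in> su2"
  shows "Re (X $ 1 $ 1) = 0" "X $ 2 $ 2 = - X $ 1 $ 1" "X $ 2 $ 1 = - cnj (X $ 1 $ 2)"
proof -
  have a: "cnj (X $ 1 $ 1) = - X $ 1 $ 1" "cnj (X $ 1 $ 2) = - X $ 2 $ 1"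
    and t: "X $ 1 $ 1 + X $ 2 $ 2 = 0"
    using assms by (auto simp: su2_def trace_def sum_2)
  show "Re (X $ 1 $ 1) = 0" using a(1) by (simp add: complex_eq_iff)
  show "X $ 2 $ 2 = - X $ 1 $ 1" using t by (simp add: add_eq_0_iff)
  show "X $ 2 $ 1 = - cnj (X $ 1 $ 2)" using a(2) by simp
qed

lemma su2_inner_eq_trace:
  assumes "X \<in> su2" "Y \<in> su2"
  shows "of_real (su2_inner X Y) = - trace (X ** Y)"
  using su2_entries[OF assms(1)] su2_entries[OF assms(2)]
  by (simp add: su2_inner_def trace_def matrix_matrix_mult_def sum_2 complex_eq_iff)

lemma su2_norm_eq_norm:
  assumes "X \<in> su2"
  shows "su2_norm X = norm X"
  using su2_entries[OF assms]
  by (simp add: su2_norm_def su2_inner_def trace_def matrix_matrix_mult_def sum_2 norm_vec_def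
      L2_set_def real_sqrt_pow2 cmod_def power2_eq_square)

lemma delta1_subset_su2: "delta1 \<subseteq> su2"
proof -
  have "subspace su2"
    by (auto simp: subspace_def su2_def trace_add)
      (simp_all add: trace_def sum_2 scaleR_right_distrib[symmetric])
  moreover have "{i_over_sqrt2_times pauli1, i_over_sqrt2_times pauli2} \<subseteq> su2"
    by (auto simp: su2_def i_over_sqrt2_times_def pauli1_def pauli2_def trace_def sum_2
        forall_2 vector_2)
  ultimately show ?thesis
    unfolding delta1_def by (intro span_minimal)
qed

definition vderiv :: "(real \<Rightarrow> 'a::real_normed_vector) \<Rightarrow> real \<Rightarrow> 'a" where
  "vderiv f t = vector_derivative f (at t)"

definition smooth :: "(real \<Rightarrow> 'a::real_normed_vector) \<Rightarrow> bool" where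
  "smooth f \<longleftrightarrow> (\<forall>n t. ((vderiv ^^ n) f) differentiable (at t))"

definition null_sub_riemannian_lie_quadratic :: "(real \<Rightarrow> cmat2) \<Rightarrow> bool" where
  "null_sub_riemannian_lie_quadratic V \<longleftrightarrow>
     smooth V \<and> (\<forall>t. V t \<in> delta1) \<and>
     (\<forall>t. (vderiv ^^ 3) V t = bracket (bracket (vderiv V t) (V t)) (V t))"

definition constant_value :: "(real \<Rightarrow> real) \<Rightarrow> real" where
  "constant_value f = (THE c. \<forall>t. f t = c)"

definition c1 :: "(real \<Rightarrow> cmat2) \<Rightarrow> real" where
  "c1 V = constant_value
     (\<lambda>t. su2_inner ((vderiv ^^ 2) V t) (V t) - 1/2 * su2_inner (vderiv V t) (vderiv V t))"

definition c2 :: "(real \<Rightarrow> cmat2) \<Rightarrow> real" where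
  "c2 V = constant_value
     (\<lambda>t. su2_inner ((vderiv ^^ 2) V t) ((vderiv ^^ 2) V t) +
          su2_inner (bracket (vderiv V t) (V t)) (bracket (vderiv V t) (V t)))"

definition curly_V :: "(real \<Rightarrow> cmat2) \<Rightarrow> real \<Rightarrow> cmat2" where
  "curly_V V t = V t + (1 / (2 * (su2_norm (V t))\<^sup>2)) *\<^sub>R (vderiv ^^ 2) V t"

text \<open>The speed \<open>q\<close> has a unique minimum \<open>t0\<close> (the square of \<open>q\<close> is strictly convex), and the
  sign in a bound involving the limit at plus or minus infinity has to be read as plus for
  \<open>t \<ge> t0\<close> and minus for \<open>t \<le> t0\<close>. A bound \<open>sqrt (c2 V) / (2 * q t ^ 3)\<close> for both signs
  at every \<open>t\<close> would force the two limits to be equal: let \<open>t\<close> tend to the opposite end.\<close>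

definition alpha_plus :: "(real \<Rightarrow> cmat2) \<Rightarrow> cmat2" where
  "alpha_plus V = Lim at_top (\<lambda>t. V t /\<^sub>R su2_norm (V t))"

definition alpha_minus :: "(real \<Rightarrow> cmat2) \<Rightarrow> cmat2" where
  "alpha_minus V = Lim at_bot (\<lambda>t. V t /\<^sub>R su2_norm (V t))"

end

theory Submission
  imports Defs
begin

text \<open>On \<open>su2\<close> the double bracket is \<open>[[Y, X], X] = 2 (\<langle>X, Y\<rangle> X - \<langle>X, X\<rangle> Y)\<close>, so the equation
  reads \<open>x''' = 2 (\<langle>x, x'\<rangle> x - \<langle>x, x\<rangle> x')\<close>, which makes sense in every inner product space. With
  \<open>q = \<parallel>x\<parallel>\<close> this says \<open>(x / q)' = - x''' / (2 q^3)\<close>, hence \<open>u = x / q + x'' / (2 q^3)\<close> satisfies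
  \<open>u' = - 3 q' x'' / (2 q^4)\<close>. As \<open>\<parallel>x''\<parallel> \<le> sqrt c2\<close>, the increments of \<open>u\<close> are dominated by those of
  \<open>- sqrt c2 / (2 q^3)\<close> wherever \<open>q\<close> increases. Finally \<open>(q^2)'' = 2 c1 + 3 \<parallel>x'\<parallel>^2 \<ge> 2 c1\<close>, so \<open>q\<close>
  has a minimum, is monotone on either side of it, and tends to infinity.\<close>

section \<open>Limits at infinity and derivatives of curves\<close>

lemma constant_value_eqI:
  assumes "\<And>t. f t = c"
  shows "constant_value f = c"
  unfolding constant_value_def using assms by auto

text \<open>The bound makes the values at integers Cauchy. Letting \<open>s\<close> tend to infinity
  along the integers turns the bound on increments into a bound on the distance to the limit, and
  this in turn gives convergence along all reals.\<close>

lemma convergent_at_top_tail_bound: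
  fixes u :: "real \<Rightarrow> 'a::banach"
  assumes bound: "\<And>s t. a \<le> t \<Longrightarrow> t \<le> s \<Longrightarrow> norm (u s - u t) \<le> e t"
    and e: "(e \<longlongrightarrow> 0) at_top"
  obtains L where "(u \<longlongrightarrow> L) at_top" "\<And>t. a \<le> t \<Longrightarrow> norm (u t - L) \<le> e t"
proof -
  have "Cauchy (\<lambda>n. u (real n))"
  proof (rule CauchyI')
    fix d :: real assume "d > 0"
    then have "\<forall>\<^sub>F t in at_top. e t < d"
      using order_tendstoD(2)[OF e] by blast
    then obtain b where b: "\<And>t. b \<le> t \<Longrightarrow> e t < d"
      by (auto simp: eventually_at_top_linorder)
    obtain N where N: "max a b \<le> real N"
      using real_arch_simple by blast
    show "\<exists>N. \<forall>m\<ge>N. \<forall>n>m. dist (u (real m)) (u (real n)) < d"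
    proof (intro exI[of _ N] allI impI)
      fix m n assume "N \<le> m" "m < n"
      then have m: "a \<le> real m" "b \<le> real m" "real m \<le> real n" using N by auto
      show "dist (u (real m)) (u (real n)) < d"
        using bound[OF m(1,3)] b[OF m(2)] by (simp add: dist_norm norm_minus_commute)
    qed
  qed
  then obtain L where L: "(\<lambda>n. u (real n)) \<longlonglongrightarrow> L"
    by (auto simp: Cauchy_convergent_iff convergent_def)
  have tail: "norm (u t - L) \<le> e t" if "a \<le> t" for t
  proof (rule tendsto_upperbound)
    show "(\<lambda>n. norm (u t - u (real n))) \<longlonglongrightarrow> norm (u t - L)"
      by (intro tendsto_intros L)
    have "\<forall>\<^sub>F n in sequentially. t \<le> real n"
      using filterlim_at_top filterlim_real_sequentially by blast
    then show "\<forall>\<^sub>F n in sequentially. norm (u t - u (real n)) \<le> e t"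
      by eventually_elim (metis bound norm_minus_commute that)
  qed simp
  have "\<forall>\<^sub>F t in at_top. norm (u t - L) \<le> e t"
    using eventually_ge_at_top[of a] by eventually_elim (rule tail)
  then have "((\<lambda>t. u t - L) \<longlongrightarrow> 0) at_top"
    using e by (rule Lim_null_comparison)
  then have "(u \<longlongrightarrow> L) at_top"
    by (simp add: LIM_zero_iff)
  then show thesis using tail by (rule that)
qed

text \<open>Difference quotients stay in \<open>S\<close>, and so does their limit. This keeps every
  derivative of \<open>V\<close> in \<open>su2\<close>, where the trace identities hold.\<close>

lemma vector_derivative_in_closed_subspace:
  assumes S: "subspace S" "closed S"
    and f: "\<And>s. f s \<in> S" and D: "(f has_vector_derivative D) (at (t::real))"
  shows "D \<in> S"
proof (rule Lim_in_closed_set[OF S(2)])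
  have "((\<lambda>s. norm (f s - f t - (s - t) *\<^sub>R D) / norm (s - t)) \<longlongrightarrow> 0) (at t)"
    using D by (auto simp: has_vector_derivative_def has_derivative_iff_norm)
  moreover have "\<forall>\<^sub>F s in at t. norm (f s - f t - (s - t) *\<^sub>R D) / norm (s - t)
      = norm ((f s - f t) /\<^sub>R (s - t) - D)"
  proof (rule eventually_at_filter[THEN iffD2], rule always_eventually, intro allI impI)
    fix s assume "s \<noteq> t"
    then have "(f s - f t) /\<^sub>R (s - t) - D = (f s - f t - (s - t) *\<^sub>R D) /\<^sub>R (s - t)"
      by (simp add: scaleR_diff_right)
    then show "norm (f s - f t - (s - t) *\<^sub>R D) / norm (s - t) = norm ((f s - f t) /\<^sub>R (s - t) - D)"
      by (simp add: divide_inverse)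
  qed
  ultimately have "((\<lambda>s. norm ((f s - f t) /\<^sub>R (s - t) - D)) \<longlongrightarrow> 0) (at t)"
    by (rule Lim_transform_eventually)
  then show "((\<lambda>s. (f s - f t) /\<^sub>R (s - t)) \<longlongrightarrow> D) (at t)"
    by (rule LIM_zero_cancel[OF tendsto_norm_zero_cancel])
  show "\<forall>\<^sub>F s in at t. (f s - f t) /\<^sub>R (s - t) \<in> S"
    by (intro always_eventually allI subspace_scale subspace_diff S f)
qed simp

lemma has_real_derivative_inner:
  fixes f g :: "real \<Rightarrow> 'a::real_inner"
  assumes "(f has_vector_derivative f') (at t)" "(g has_vector_derivative g') (at t)"
  shows "((\<lambda>t. f t \<bullet> g t) has_real_derivative f t \<bullet> g' + f' \<bullet> g t) (at t)"
  using has_derivative_inner[OF assms[unfolded has_vector_derivative_def]]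
  by (rule has_derivative_imp_has_field_derivative) (simp add: algebra_simps)

subsection \<open>Null quadratics in an inner product space\<close>

text \<open>The derivatives are parameters, so that the time-reversed curve is again an
  instance.\<close>

locale null_quadratic =
  fixes x x1 x2 :: "real \<Rightarrow> 'a::{real_inner,banach}"
  assumes deriv_x: "\<And>t. (x has_vector_derivative x1 t) (at t)"
    and deriv_x1: "\<And>t. (x1 has_vector_derivative x2 t) (at t)"
    and deriv_x2: "\<And>t. (x2 has_vector_derivative
          2 *\<^sub>R ((x t \<bullet> x1 t) *\<^sub>R x t - (x t \<bullet> x t) *\<^sub>R x1 t)) (at t)"
    and nonzero: "\<And>t. x t \<noteq> 0"
begin

section \<open>Two conserved quantities\<close>

lemmas derivs = has_real_derivative_inner[OF deriv_x deriv_x] has_real_derivative_inner[OF deriv_x deriv_x1]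
  has_real_derivative_inner[OF deriv_x2 deriv_x2] has_real_derivative_inner[OF deriv_x2 deriv_x]
  has_real_derivative_inner[OF deriv_x1 deriv_x1]

text \<open>The terms in \<open>x1\<close> and \<open>x2\<close> cancel on differentiation, and the
  third derivative is orthogonal to \<open>x\<close>.\<close>

lemma first_integral1:
  "x2 t \<bullet> x t - 1/2 * (x1 t \<bullet> x1 t) = x2 s \<bullet> x s - 1/2 * (x1 s \<bullet> x1 s)"
proof (rule DERIV_isconst_all[where f = "\<lambda>t. x2 t \<bullet> x t - 1/2 * (x1 t \<bullet> x1 t)"], rule allI)
  show "((\<lambda>t. x2 t \<bullet> x t - 1/2 * (x1 t \<bullet> x1 t)) has_real_derivative 0) (at t)" for t
    by (rule derivative_eq_intros derivs refl)+
      (simp add: inner_commute algebra_simps)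
qed

text \<open>The second summand is twice the Gram determinant of \<open>x\<close> and
  \<open>x1\<close>; in \<open>su2\<close> it is the squared norm of the bracket, so
  \<open>energy\<close> becomes \<open>c2\<close>.\<close>

definition "energy t = x2 t \<bullet> x2 t + 2 * ((x t \<bullet> x t) * (x1 t \<bullet> x1 t) - (x t \<bullet> x1 t)\<^sup>2)"

lemma energy_const: "energy t = energy s"
proof (rule DERIV_isconst_all[where f = energy], rule allI)
  show "(energy has_real_derivative 0) (at t)" for t
    unfolding energy_def
    by (rule derivative_eq_intros derivs refl)+
      (simp add: inner_commute algebra_simps)
qed

text \<open>The Gram determinant is nonnegative by Cauchy-Schwarz. Since the energy is constant, it
  may be evaluated at any other time \<open>s\<close>.\<close>

lemma norm_x2_le: "norm (x2 t) \<le> sqrt (energy s)"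
proof -
  have "(norm (x2 t))\<^sup>2 \<le> energy t"
    using Cauchy_Schwarz_ineq[of "x t" "x1 t"] by (simp add: energy_def power2_norm_eq_inner)
  then show ?thesis
    using energy_const[of t s] real_le_rsqrt by simp
qed

section \<open>The curve \<open>u\<close> and its increments\<close>

lemma deriv_norm: "((\<lambda>t. norm (x t)) has_real_derivative (x t \<bullet> x1 t) / norm (x t)) (at t)"
  unfolding norm_eq_sqrt_inner
  using DERIV_chain2[OF DERIV_real_sqrt derivs(1)]
  by (rule DERIV_cong) (simp_all add: nonzero inner_commute divide_simps)

lemma deriv_inverse_norm:
  "((\<lambda>t. inverse (norm (x t))) has_real_derivative - ((x t \<bullet> x1 t) / norm (x t) ^ 3)) (at t)"
  using DERIV_inverse'[OF deriv_norm, of t]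
  by (rule DERIV_cong) (simp_all add: nonzero field_simps power3_eq_cube)

lemma deriv_inverse_norm_cube:
  "((\<lambda>t. 1 / (2 * norm (x t) ^ 3)) has_real_derivative
    - (3 * (x t \<bullet> x1 t) / (2 * norm (x t) ^ 5))) (at t)"
proof -
  have "((\<lambda>t. 1/2 * inverse (norm (x t)) ^ 3) has_real_derivative
    - (3 * (x t \<bullet> x1 t) / (2 * norm (x t) ^ 5))) (at t)"
    using DERIV_cmult[OF DERIV_power[OF deriv_inverse_norm], of "1/2" 3 t]
    by (rule DERIV_cong) (simp add: nonzero field_simps eval_nat_numeral)
  then show ?thesis by (simp add: field_simps)
qed

definition "u t = x t /\<^sub>R norm (x t) + (1 / (2 * norm (x t) ^ 3)) *\<^sub>R x2 t"

lemma deriv_u: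
  "(u has_vector_derivative - (3 * (x t \<bullet> x1 t) / (2 * norm (x t) ^ 5)) *\<^sub>R x2 t) (at t)"
proof -
  \<comment> \<open>This scalar identity makes the third-derivative term of the product rule cancel
    the derivative of \<open>x / norm x\<close>.\<close>
  have "(1 / (2 * norm (x t) ^ 3)) * (2 * (x t \<bullet> x t)) = inverse (norm (x t))"
    by (simp add: nonzero field_simps eval_nat_numeral flip: power2_norm_eq_inner)
  then have "(1 / (2 * norm (x t) ^ 3)) *\<^sub>R (2 *\<^sub>R ((x t \<bullet> x1 t) *\<^sub>R x t - (x t \<bullet> x t) *\<^sub>R x1 t))
      = ((x t \<bullet> x1 t) / norm (x t) ^ 3) *\<^sub>R x t - inverse (norm (x t)) *\<^sub>R x1 t"
    by (simp add: scaleR_diff_right)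
  then show ?thesis
    unfolding u_def
    using has_vector_derivative_add[OF
        has_vector_derivative_scaleR[OF deriv_inverse_norm deriv_x]
        has_vector_derivative_scaleR[OF deriv_inverse_norm_cube deriv_x2], of t]
    by simp
qed

lemma u_increment:
  assumes "t \<le> s" "\<And>r. t \<le> r \<Longrightarrow> 0 \<le> x r \<bullet> x1 r"
  shows "norm (u s - u t)
    \<le> sqrt (energy 0) / (2 * norm (x t) ^ 3) - sqrt (energy 0) / (2 * norm (x s) ^ 3)"
proof (cases "t = s")
  case False
  define K where "K = sqrt (energy 0)"
  \<comment> \<open>Where \<open>x r \<bullet> x1 r\<close> is nonnegative, the derivative of \<phi>
    dominates the norm of the derivative of \<open>u\<close>, so the mean value inequality
    applies.\<close>
  define \<phi> where "\<phi> = (\<lambda>r. - (K / (2 * norm (x r) ^ 3)))"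
  have \<phi>: "(\<phi> has_vector_derivative (3 * (x r \<bullet> x1 r) / (2 * norm (x r) ^ 5)) * K) (at r)" for r
    unfolding \<phi>_def has_real_derivative_iff_has_vector_derivative[symmetric]
    using DERIV_cmult[OF deriv_inverse_norm_cube, of "- K" r] by (simp add: mult.commute)
  have "norm (u s - u t) \<le> \<phi> s - \<phi> t"
  proof (rule differentiable_bound_general)
    show "t < s" using False assms by simp
    show "continuous_on {t..s} u" "continuous_on {t..s} \<phi>"
      using deriv_u \<phi> by (meson continuous_at_imp_continuous_on has_vector_derivative_continuous)+
    fix r assume "t < r" "r < s"
    then have "0 \<le> 3 * (x r \<bullet> x1 r) / (2 * norm (x r) ^ 5)" using assms by simp
    then show "norm (- (3 * (x r \<bullet> x1 r) / (2 * norm (x r) ^ 5)) *\<^sub>R x2 r)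
      \<le> (3 * (x r \<bullet> x1 r) / (2 * norm (x r) ^ 5)) * K"
      using mult_left_mono[OF norm_x2_le[of r 0, folded K_def]] by (simp only: norm_scaleR abs_minus abs_of_nonneg)
  qed (rule deriv_u \<phi>)+
  then show ?thesis by (simp add: \<phi>_def K_def)
qed simp

section \<open>Growth of the norm and the limit at plus infinity\<close>

context
  fixes c :: real
  assumes c_pos: "c > 0" and c_eq: "\<And>t. x2 t \<bullet> x t - 1/2 * (x1 t \<bullet> x1 t) = c"
begin

text \<open>By \<open>c_eq\<close> the derivative of \<open>x t \<bullet> x1 t\<close> is
  \<open>c\<close> plus 3/2 of the squared norm of \<open>x1\<close>, hence at least
  \<open>c\<close>.\<close>

lemma inner_growth:
  assumes "s \<le> t"
  shows "x s \<bullet> x1 s + c * (t - s) \<le> x t \<bullet> x1 t"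
proof -
  have "x s \<bullet> x1 s - c * s \<le> x t \<bullet> x1 t - c * t"
  proof (rule DERIV_nonneg_imp_nondecreasing[OF assms])
    fix r
    have "((\<lambda>t. x t \<bullet> x1 t - c * t) has_real_derivative x r \<bullet> x2 r + x1 r \<bullet> x1 r - c) (at r)"
      by (rule derivative_eq_intros derivs refl)+ simp
    moreover have "0 \<le> x r \<bullet> x2 r + x1 r \<bullet> x1 r - c"
      using c_eq[of r] inner_ge_zero[of "x1 r"] unfolding inner_commute[of "x2 r"] by linarith
    ultimately show "\<exists>y. ((\<lambda>t. x t \<bullet> x1 t - c * t) has_real_derivative y) (at r) \<and> 0 \<le> y"
      by blast
  qed
  then show ?thesis by (simp add: algebra_simps)
qed

lemma critical_point_exists: "\<exists>t0. x t0 \<bullet> x1 t0 = 0"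
proof -
  \<comment> \<open>With this \<open>b\<close>, growth at rate \<open>c\<close> over time
    \<open>b\<close> outweighs the value at 0, which forces opposite signs at \<open>-b\<close> and
    \<open>b\<close>.\<close>
  define b where "b = \<bar>x 0 \<bullet> x1 0\<bar> / c"
  have b: "0 \<le> b" "c * b = \<bar>x 0 \<bullet> x1 0\<bar>" using c_pos by (auto simp: b_def)
  have "continuous_on {-b..b} (\<lambda>t. x t \<bullet> x1 t)"
    using derivs(2) by (meson DERIV_isCont continuous_at_imp_continuous_on)
  moreover have "x (-b) \<bullet> x1 (-b) \<le> 0" "0 \<le> x b \<bullet> x1 b"
    using inner_growth[of 0 b] inner_growth[of "-b" 0] b by auto
  ultimately show ?thesis
    using IVT'[of "\<lambda>t. x t \<bullet> x1 t" "-b" 0 b] b(1) by auto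
qed

text \<open>Integrated form of \<open>inner_growth\<close>: the difference \<open>?h\<close>
  decreases up to \<open>t0\<close> and increases afterwards.\<close>

lemma quadratic_growth:
  assumes t0: "x t0 \<bullet> x1 t0 = 0"
  shows "x t0 \<bullet> x t0 + c * (t - t0)\<^sup>2 \<le> x t \<bullet> x t"
proof -
  let ?h = "\<lambda>t. x t \<bullet> x t - c * (t - t0)\<^sup>2"
  have D: "(?h has_real_derivative 2 * (x r \<bullet> x1 r - c * (r - t0))) (at r)" for r
    by (rule derivative_eq_intros derivs refl)+ (simp add: inner_commute algebra_simps)
  have "?h t0 \<le> ?h t"
  proof (cases "t0 \<le> t")
    case True
    show ?thesis
    proof (rule DERIV_nonneg_imp_nondecreasing[where f = ?h, OF True])
      fix r assume "t0 \<le> r"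
      then have "0 \<le> 2 * (x r \<bullet> x1 r - c * (r - t0))"
        using inner_growth[of t0 r] t0 by simp
      then show "\<exists>y. (?h has_real_derivative y) (at r) \<and> 0 \<le> y"
        using D by blast
    qed
  next
    case False
    show ?thesis
    proof (rule DERIV_nonpos_imp_nonincreasing[where f = ?h])
      show "t \<le> t0" using False by simp
      fix r assume "r \<le> t0"
      then have "2 * (x r \<bullet> x1 r - c * (r - t0)) \<le> 0"
        using inner_growth[of r t0] t0 by (simp add: algebra_simps)
      then show "\<exists>y. (?h has_real_derivative y) (at r) \<and> y \<le> 0"
        using D by blast
    qed
  qed
  then show ?thesis by simp
qed

lemma norm_minimal:
  assumes "x t0 \<bullet> x1 t0 = 0"
  shows "norm (x t0) \<le> norm (x t)"
proof -
  have "0 \<le> c * (t - t0)\<^sup>2" using c_pos by simp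
  then show ?thesis
    using quadratic_growth[OF assms, of t] by (simp add: norm_le)
qed

lemma filterlim_norm_at_top: "filterlim (\<lambda>t. norm (x t)) at_top at_top"
proof -
  obtain t0 where t0: "x t0 \<bullet> x1 t0 = 0" using critical_point_exists by blast
  \<comment> \<open>For \<open>t\<close> below \<open>t0\<close> the left side is negative, but
    comparing squares only requires the right side to be nonnegative.\<close>
  have "sqrt c * (t - t0) \<le> norm (x t)" for t
  proof (rule power2_le_imp_le)
    show "(sqrt c * (t - t0))\<^sup>2 \<le> (norm (x t))\<^sup>2"
      using quadratic_growth[OF t0, of t] c_pos inner_ge_zero[of "x t0"]
      by (simp add: power_mult_distrib power2_norm_eq_inner del: inner_ge_zero)
  qed simp
  moreover have "filterlim (\<lambda>t. sqrt c * (t - t0)) at_top at_top"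
    using c_pos
    by (intro filterlim_tendsto_pos_mult_at_top[OF tendsto_const])
      (auto intro: filterlim_tendsto_add_at_top[OF tendsto_const[of "-t0"] filterlim_ident, simplified])
  ultimately show ?thesis
    by (rule filterlim_at_top_mono[OF _ always_eventually, rotated, OF allI])
qed

text \<open>To the right of \<open>t0\<close> the norm increases, so \<open>u_increment\<close>
  gives the tail bound for \<open>u\<close>. The normalized curve has the same limit as
  \<open>u\<close>, since they differ by a term of norm at most \<open>e t\<close>, which vanishes
  at infinity.\<close>

lemma limit_bound_at_top:
  assumes t0: "x t0 \<bullet> x1 t0 = 0"
  obtains L where "((\<lambda>t. x t /\<^sub>R norm (x t)) \<longlongrightarrow> L) at_top"
    "\<And>t. t0 \<le> t \<Longrightarrow> norm (u t - L) \<le> sqrt (energy 0) / (2 * norm (x t) ^ 3)"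
proof -
  define e where "e = (\<lambda>t. sqrt (energy 0) / (2 * norm (x t) ^ 3))"
  have "filterlim (\<lambda>t. norm (x t) ^ 3) at_top at_top"
    by (intro filterlim_pow_at_top filterlim_norm_at_top) simp
  then have "filterlim (\<lambda>t. 2 * norm (x t) ^ 3) at_top at_top"
    by (rule filterlim_tendsto_pos_mult_at_top[OF tendsto_const, rotated]) simp
  then have e: "(e \<longlongrightarrow> 0) at_top"
    unfolding e_def by (rule real_tendsto_divide_at_top[OF tendsto_const])
  have E: "0 \<le> sqrt (energy 0)" using norm_x2_le[of 0 0] norm_ge_zero order_trans by blast
  have bound: "norm (u s - u t) \<le> e t" if ts: "t0 \<le> t" "t \<le> s" for s t
  proof -
    have "0 \<le> x r \<bullet> x1 r" if "t \<le> r" for r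
      using inner_growth[of t0 r] t0 ts that mult_nonneg_nonneg[of c "r - t0"] c_pos by linarith
    moreover have "0 \<le> e s" using E by (simp add: e_def)
    ultimately show ?thesis
      using u_increment[OF ts(2), folded e_def] by (simp add: e_def)
  qed
  obtain L where L: "(u \<longlongrightarrow> L) at_top" "\<And>t. t0 \<le> t \<Longrightarrow> norm (u t - L) \<le> e t"
    using convergent_at_top_tail_bound[OF bound e] by blast
  have "((\<lambda>t. (1 / (2 * norm (x t) ^ 3)) *\<^sub>R x2 t) \<longlongrightarrow> 0) at_top"
  proof (rule Lim_null_comparison[OF _ e], rule always_eventually, rule allI)
    show "norm ((1 / (2 * norm (x t) ^ 3)) *\<^sub>R x2 t) \<le> e t" for t
      using norm_x2_le[of t 0] by (simp add: e_def divide_right_mono)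
  qed
  then have "((\<lambda>t. x t /\<^sub>R norm (x t)) \<longlongrightarrow> L) at_top"
    using tendsto_diff[OF L(1)] by (fastforce simp: u_def)
  then show thesis using L(2) by (intro that) (simp_all add: e_def)
qed

end

text \<open>Under time reversal odd derivatives change sign, and the right side of the equation is
  linear in \<open>x1\<close>, so both sides change sign together.\<close>

lemma reversed: "null_quadratic (\<lambda>t. x (- t)) (\<lambda>t. - x1 (- t)) (\<lambda>t. x2 (- t))"
proof
  have R: "((\<lambda>t. f (- t)) has_vector_derivative - f') (at t)"
    if "(f has_vector_derivative f') (at (- t))" for f :: "real \<Rightarrow> 'a" and f' t
    using vector_diff_chain_at[of uminus "-1" t f f'] that
      has_vector_derivative_minus[OF has_vector_derivative_id[of "at t"]]
    by (simp add: o_def)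
  fix t
  show "((\<lambda>t. x (- t)) has_vector_derivative - x1 (- t)) (at t)"
    by (rule R deriv_x)+
  show "((\<lambda>t. - x1 (- t)) has_vector_derivative x2 (- t)) (at t)"
    using has_vector_derivative_minus[OF R[OF deriv_x1]] by simp
  show "((\<lambda>t. x2 (- t)) has_vector_derivative
      2 *\<^sub>R ((x (- t) \<bullet> - x1 (- t)) *\<^sub>R x (- t) - (x (- t) \<bullet> x (- t)) *\<^sub>R - x1 (- t))) (at t)"
    using R[OF deriv_x2, of t] by (simp add: algebra_simps)
  show "x (- t) \<noteq> 0" by (rule nonzero)
qed

lemma limit_bound_at_bot:
  assumes c: "c > 0" "\<And>t. x2 t \<bullet> x t - 1/2 * (x1 t \<bullet> x1 t) = c" and t0: "x t0 \<bullet> x1 t0 = 0"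
  obtains L where "((\<lambda>t. x t /\<^sub>R norm (x t)) \<longlongrightarrow> L) at_bot"
    "\<And>t. t \<le> t0 \<Longrightarrow> norm (u t - L) \<le> sqrt (energy 0) / (2 * norm (x t) ^ 3)"
proof -
  interpret R: null_quadratic "\<lambda>t. x (- t)" "\<lambda>t. - x1 (- t)" "\<lambda>t. x2 (- t)" by (rule reversed)
  \<comment> \<open>\<open>u\<close> does not involve \<open>x1\<close>, and \<open>energy\<close>
    is even in it.\<close>
  have R: "R.u t = u (- t)" "R.energy 0 = energy 0" for t
    by (simp_all add: R.u_def u_def R.energy_def energy_def)
  obtain L where L: "((\<lambda>t. x (- t) /\<^sub>R norm (x (- t))) \<longlongrightarrow> L) at_top"
    "\<And>t. - t0 \<le> t \<Longrightarrow> norm (u (- t) - L) \<le> sqrt (energy 0) / (2 * norm (x (- t)) ^ 3)"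
    using R.limit_bound_at_top[of c "- t0"] c t0 unfolding R by auto
  show thesis
    using L(1) L(2)[of "- t" for t] by (intro that[of L]) (simp_all add: filterlim_at_bot_mirror)
qed

end

subsection \<open>The Lie algebra \<open>su2\<close>\<close>

text \<open>As \<open>Y\<close> is skew-Hermitian, minus the trace of \<open>X ** Y\<close> is the
  trace of \<open>X\<close> times the adjoint of \<open>Y\<close>, whose real part is the library
  inner product.\<close>

lemma su2_inner_eq_inner:
  assumes "X \<in> su2" "Y \<in> su2"
  shows "su2_inner X Y = X \<bullet> Y"
  using su2_entries[OF assms(1)] su2_entries[OF assms(2)]
  by (simp add: su2_inner_def trace_def matrix_matrix_mult_def sum_2 inner_vec_def inner_complex_def)

text \<open>In the orthonormal Pauli basis the bracket is, up to sign, \<open>sqrt 2\<close> times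
  the cross product on three-space; this is the triple product expansion.\<close>

lemma bracket_bracket_su2:
  assumes "X \<in> su2" "Y \<in> su2"
  shows "bracket (bracket Y X) X = 2 *\<^sub>R ((X \<bullet> Y) *\<^sub>R X - (X \<bullet> X) *\<^sub>R Y)"
  using su2_entries[OF assms(1)] su2_entries[OF assms(2)]
  by (simp add: bracket_def matrix_matrix_mult_def sum_2 inner_vec_def inner_complex_def
      vec_eq_iff forall_2 complex_eq_iff algebra_simps)

text \<open>Lagrange's identity for the same cross product; the factor 2 is the square of
  \<open>sqrt 2\<close>.\<close>

lemma su2_inner_bracket:
  assumes "X \<in> su2" "Y \<in> su2"
  shows "su2_inner (bracket Y X) (bracket Y X) = 2 * ((X \<bullet> X) * (Y \<bullet> Y) - (X \<bullet> Y)\<^sup>2)"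
  using su2_entries[OF assms(1)] su2_entries[OF assms(2)]
  by (simp add: su2_inner_def trace_def bracket_def matrix_matrix_mult_def sum_2 inner_vec_def
      inner_complex_def power2_eq_square algebra_simps)

lemma subspace_su2: "subspace su2"
  by (auto simp: subspace_def su2_def trace_add)
    (simp_all add: trace_def sum_2 scaleR_right_distrib[symmetric])

lemma closed_su2: "closed su2"
  by (rule closed_subspace[OF subspace_su2])

section \<open>The bound for null quadratics in \<open>su2\<close>\<close>

theorem mainTheorem6:
  fixes V :: "real \<Rightarrow> cmat2" and q :: "real \<Rightarrow> real"
  assumes "null_sub_riemannian_lie_quadratic V"
    and "\<And>t. V t \<noteq> 0"
    and "c1 V > 0"
    and "\<And>t. q t = su2_norm (V t)"
  shows "\<exists>t0. (\<forall>t. q t0 \<le> q t) \<and>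
           (\<forall>t. (t0 \<le> t \<longrightarrow>
                   su2_norm (curly_V V t /\<^sub>R q t - alpha_plus V) \<le> sqrt (c2 V) / (2 * q t ^ 3)) \<and>
                (t \<le> t0 \<longrightarrow>
                   su2_norm (curly_V V t /\<^sub>R q t - alpha_minus V) \<le> sqrt (c2 V) / (2 * q t ^ 3)))"
proof -
  \<comment> \<open>Indexing the iterated derivatives lets one induction place all of them in
    \<open>su2\<close>.\<close>
  define W where "W = (\<lambda>n. (vderiv ^^ n) V)"
  have W0: "W 0 = V" by (simp add: W_def)
  have deriv: "(W n has_vector_derivative W (Suc n) t) (at t)" for n t
    using assms(1)
    by (simp add: W_def vderiv_def null_sub_riemannian_lie_quadratic_def smooth_def
        vector_derivative_works)
  have su2: "W n t \<in> su2" for n t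
  proof (induction n arbitrary: t)
    case 0
    show ?case
      using assms(1) delta1_subset_su2 by (auto simp: W_def null_sub_riemannian_lie_quadratic_def)
  next
    case (Suc n)
    then show ?case
      by (rule vector_derivative_in_closed_subspace[OF subspace_su2 closed_su2 _ deriv])
  qed
  note V_su2 = su2[of 0, unfolded W0]
  have W3: "W 3 t = 2 *\<^sub>R ((V t \<bullet> W 1 t) *\<^sub>R V t - (V t \<bullet> V t) *\<^sub>R W 1 t)" for t
    using assms(1) bracket_bracket_su2[OF V_su2 su2[of 1]]
    by (simp add: W_def null_sub_riemannian_lie_quadratic_def)
  interpret null_quadratic V "W 1" "W 2"
  proof
    fix t
    show "(V has_vector_derivative W 1 t) (at t)" using deriv[of 0 t] by (simp add: W0)
    show "(W 1 has_vector_derivative W 2 t) (at t)" using deriv[of 1 t] by (simp add: numeral_2_eq_2)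
    show "(W 2 has_vector_derivative
        2 *\<^sub>R ((V t \<bullet> W 1 t) *\<^sub>R V t - (V t \<bullet> V t) *\<^sub>R W 1 t)) (at t)"
      using deriv[of 2 t] W3[of t] by (simp add: numeral_3_eq_3 numeral_2_eq_2)
    show "V t \<noteq> 0" by (rule assms(2))
  qed
  have q: "q t = norm (V t)" for t
    using assms(4) su2_norm_eq_norm V_su2 by simp
  have V1: "vderiv V = W 1" by (simp add: W_def)
  have V2: "(vderiv ^^ 2) V = W 2" by (simp add: W_def)
  have "c1 V = W 2 t \<bullet> V t - 1/2 * (W 1 t \<bullet> W 1 t)" for t
    unfolding c1_def V1 V2 su2_inner_eq_inner[OF su2 V_su2] su2_inner_eq_inner[OF su2 su2]
    by (intro constant_value_eqI first_integral1)
  then have c1: "W 2 t \<bullet> V t - 1/2 * (W 1 t \<bullet> W 1 t) = c1 V" for t by simp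
  have c2: "c2 V = energy 0"
    unfolding c2_def V1 V2 su2_inner_bracket[OF V_su2 su2] su2_inner_eq_inner[OF su2 su2]
    unfolding energy_def[symmetric]
    by (intro constant_value_eqI energy_const)
  have u: "curly_V V t /\<^sub>R q t = u t" for t
    using assms(2)[of t] su2_norm_eq_norm[OF V_su2]
    by (simp add: curly_V_def u_def q V2 algebra_simps power2_eq_square power3_eq_cube divide_simps)
  have u_su2: "u t \<in> su2" for t
    unfolding u_def by (intro subspace_add subspace_scale subspace_su2 V_su2 su2)
  \<comment> \<open>The limits must lie in \<open>su2\<close> too, because \<open>su2_norm\<close>
    is known to agree with \<open>norm\<close> only there.\<close>
  have lim_su2: "L \<in> su2" if "((\<lambda>t. V t /\<^sub>R norm (V t)) \<longlongrightarrow> L) F" "F \<noteq> bot" for L F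
    using Lim_in_closed_set[OF closed_su2 _ that(2,1)] subspace_scale[OF subspace_su2 V_su2]
    by (simp add: always_eventually)
  have norm_eq: "su2_norm (u t - L) = norm (u t - L)" if "L \<in> su2" for t L
    by (intro su2_norm_eq_norm subspace_diff subspace_su2 u_su2 that)
  \<comment> \<open>This single critical point serves as the minimum of \<open>q\<close> and as the
    switch between the two bounds.\<close>
  obtain t0 where t0: "V t0 \<bullet> W 1 t0 = 0"
    using critical_point_exists[OF assms(3) c1] by blast
  obtain P where P: "((\<lambda>t. V t /\<^sub>R norm (V t)) \<longlongrightarrow> P) at_top"
    "\<And>t. t0 \<le> t \<Longrightarrow> norm (u t - P) \<le> sqrt (energy 0) / (2 * norm (V t) ^ 3)"
    using limit_bound_at_top[OF assms(3) c1 t0] by blast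
  obtain M where M: "((\<lambda>t. V t /\<^sub>R norm (V t)) \<longlongrightarrow> M) at_bot"
    "\<And>t. t \<le> t0 \<Longrightarrow> norm (u t - M) \<le> sqrt (energy 0) / (2 * norm (V t) ^ 3)"
    using limit_bound_at_bot[OF assms(3) c1 t0] by blast
  \<comment> \<open>\<open>Lim\<close> is informative only once convergence is known;
    \<open>P(1)\<close> and \<open>M(1)\<close> supply it, and uniqueness of limits identifies the
    values.\<close>
  have alpha: "alpha_plus V = P" "alpha_minus V = M"
    using P(1) M(1) su2_norm_eq_norm[OF V_su2]
    by (simp_all add: alpha_plus_def alpha_minus_def tendsto_Lim)
  show ?thesis
    unfolding u unfolding alpha c2 q
      norm_eq[OF lim_su2[OF P(1) trivial_limit_at_top_linorder]]
      norm_eq[OF lim_su2[OF M(1) trivial_limit_at_bot_linorder]]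
    using norm_minimal[OF assms(3) c1 t0] P(2) M(2) by blast
qed

end
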